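(* Let $(N,v,H)$ be any hypergraph communication situation, let $(U(H),w)$ be its uniform hyperlink game, and let $\pi$ be the position value. Then for every $i\in N$, $$\pi_i(N,v,H)=\sum_{l\in U(H)(i)}Sh_l(U(H),w).$$
   Context: A TU-game is a pair $(N,v)$ with $N$ a finite player set and $v:2^N\to\mathbf{R}$ with $v(\emptyset)=0$; it is zero-normalized if $v(\{i\})=0$ for all $i\in N$. The Shapley value of $(N,v)$ is $Sh_i(N,v)=\frac{1}{|\Sigma(N)|}\sum_{\sigma\in\Sigma(N)}\big(v(\sigma^i\cup\{i\})-v(\sigma^i)\big)$, where $\Sigma(N)$ is the set of permutations of $N$ and $\sigma^i=\{j\in N\mid\sigma(j)<\sigma(i)\}$. A hypergraph communication situation (hypergraph game) is a triple $(N,v,H)$ where $N=\{1,\dots,n\}$, $n\ge 2$, $(N,v)$ is a zero-normalized TU-game, and $H\subseteq\{e\subseteq N\mid |e|>1\}$ is a set of hyperlinks. For $i\in N$, $H_i=\{e\in H\mid i\in e\}$. For $H'\subseteq H$, two nodes are adjacent in $(N,H')$ if some hyperlink of $H'$ contains both; two nodes are connected if they are joined by a finite sequence of nodes with consecutive ones adjacent (each node is connected to itself); $N/H'$ is the set of components (maximal sets of pairwise connected nodes) of $(N,H')$. The hyperlink game $(H,v^N)$ has player set $H$ and $v^N(H')=\sum_{T\in N/H'}v(T)$ for $H'\subseteq H$. The position value is $\pi_i(N,v,H)=\sum_{e\in H_i}\frac{1}{|e|}Sh_e(H,v^N)$ for $i\in N$. Uniform hyperlink game $(U(H),w)$: let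 $\eta(H)$ be the least common multiple of the numbers in $\{|e|\mid e\in H\}$ (equal to $1$ if $H=\emptyset$). For $e\in H$ and $i\in e$ put $U(H)(i,e)=\{(i,e,k)\mid k=1,2,\dots,\eta(H)/|e|\}$; $U(H)(i)=\bigcup_{e\in H_i}U(H)(i,e)$; $U(H)(e)=\bigcup_{i\in e}U(H)(i,e)$; $U(H)=\bigcup_{i\in N}U(H)(i)=\bigcup_{e\in H}U(H)(e)$. For $S\subseteq U(H)$, $w(S)=v^N(H[S])=\sum_{R\in N/H[S]}v(R)$, where $H[S]=\{e\in H\mid U(H)(e)\subseteq S\}$. *)

theory Defs
  imports Complex_Main "HOL-Library.FuncSet"
begin

section \<open>TU-games and the Shapley value\<close>

text \<open>A characteristic function is a function on all sets of the player type; only its values on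
  subsets of the player set matter.\<close>

definition tu_game :: "'a set \<Rightarrow> ('a set \<Rightarrow> real) \<Rightarrow> bool" where
  "tu_game N v \<longleftrightarrow> finite N \<and> v {} = 0"

definition zero_normalized :: "'a set \<Rightarrow> ('a set \<Rightarrow> real) \<Rightarrow> bool" where
  "zero_normalized N v \<longleftrightarrow> (\<forall>i\<in>N. v {i} = 0)"

text \<open>The permutations of \<open>N\<close> are the bijections from \<open>N\<close> onto the ranks \<open>{1..card N}\<close>, so that
  ranks can be compared whatever the type of the players. Extensionality (\<open>\<rightarrow>\<^sub>E\<close>) makes each
  permutation be represented by exactly one function.\<close>

definition permutations_of :: "'a set \<Rightarrow> ('a \<Rightarrow> nat) set" where
  "permutations_of N = {\<sigma> \<in> N \<rightarrow>\<^sub>E {1..card N}. bij_betw \<sigma> N {1..card N}}"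

definition predecessors :: "'a set \<Rightarrow> ('a \<Rightarrow> nat) \<Rightarrow> 'a \<Rightarrow> 'a set" where
  "predecessors N \<sigma> i = {j \<in> N. \<sigma> j < \<sigma> i}"

definition shapley_value :: "'a set \<Rightarrow> ('a set \<Rightarrow> real) \<Rightarrow> 'a \<Rightarrow> real" where
  "shapley_value N v i =
     1 / real (card (permutations_of N)) *
     (\<Sum>\<sigma>\<in>permutations_of N. v (predecessors N \<sigma> i \<union> {i}) - v (predecessors N \<sigma> i))"

section \<open>Hypergraph communication situations\<close>

definition hypergraph_communication_situation ::
    "nat \<Rightarrow> (nat set \<Rightarrow> real) \<Rightarrow> nat set set \<Rightarrow> bool" where
  "hypergraph_communication_situation n v H \<longleftrightarrow>
     n \<ge> 2 \<and> tu_game {1..n} v \<and> zero_normalized {1..n} v \<and>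
     H \<subseteq> {e. e \<subseteq> {1..n} \<and> card e > 1}"

definition links_at :: "'a set set \<Rightarrow> 'a \<Rightarrow> 'a set set" where
  "links_at H i = {e \<in> H. i \<in> e}"

definition adjacent_nodes :: "'a set set \<Rightarrow> 'a \<Rightarrow> 'a \<Rightarrow> bool" where
  "adjacent_nodes H i j \<longleftrightarrow> (\<exists>e\<in>H. i \<in> e \<and> j \<in> e)"

text \<open>The one-element sequence connects each node to itself, even when no hyperlink contains it.\<close>

definition connected_nodes :: "'a set \<Rightarrow> 'a set set \<Rightarrow> 'a \<Rightarrow> 'a \<Rightarrow> bool" where
  "connected_nodes N H i j \<longleftrightarrow>
     (\<exists>xs. xs \<noteq> [] \<and> set xs \<subseteq> N \<and> hd xs = i \<and> last xs = j \<and>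
           successively (adjacent_nodes H) xs)"

definition pairwise_connected :: "'a set \<Rightarrow> 'a set set \<Rightarrow> 'a set \<Rightarrow> bool" where
  "pairwise_connected N H T \<longleftrightarrow> T \<subseteq> N \<and> (\<forall>i\<in>T. \<forall>j\<in>T. connected_nodes N H i j)"

definition hypergraph_components :: "'a set \<Rightarrow> 'a set set \<Rightarrow> 'a set set" where
  "hypergraph_components N H =
     {T. pairwise_connected N H T \<and> (\<forall>T'. pairwise_connected N H T' \<and> T \<subseteq> T' \<longrightarrow> T' = T)}"

section \<open>The hyperlink game and the position value\<close>

definition hyperlink_game :: "'a set \<Rightarrow> ('a set \<Rightarrow> real) \<Rightarrow> 'a set set \<Rightarrow> real" where
  "hyperlink_game N v H' = (\<Sum>T\<in>hypergraph_components N H'. v T)"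

definition position_value :: "'a set \<Rightarrow> ('a set \<Rightarrow> real) \<Rightarrow> 'a set set \<Rightarrow> 'a \<Rightarrow> real" where
  "position_value N v H i =
     (\<Sum>e\<in>links_at H i. 1 / real (card e) * shapley_value H (hyperlink_game N v) e)"

section \<open>The uniform hyperlink game\<close>

text \<open>\<open>Lcm {} = 1\<close> covers the empty hypergraph. The division in \<open>unit_links_at_in\<close> below is exact
  for \<open>e \<in> H\<close>.\<close>

definition eta :: "'a set set \<Rightarrow> nat" where
  "eta H = Lcm (card ` H)"

type_synonym 'a unit_link = "'a \<times> 'a set \<times> nat"

definition unit_links_at_in :: "'a set set \<Rightarrow> 'a \<Rightarrow> 'a set \<Rightarrow> 'a unit_link set" where
  "unit_links_at_in H i e = {(i, e, k) | k. k \<in> {1..eta H div card e}}"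

definition unit_links_at :: "'a set set \<Rightarrow> 'a \<Rightarrow> 'a unit_link set" where
  "unit_links_at H i = (\<Union>e\<in>links_at H i. unit_links_at_in H i e)"

definition unit_links_in :: "'a set set \<Rightarrow> 'a set \<Rightarrow> 'a unit_link set" where
  "unit_links_in H e = (\<Union>i\<in>e. unit_links_at_in H i e)"

definition unit_links :: "'a set set \<Rightarrow> 'a unit_link set" where
  "unit_links H = (\<Union>e\<in>H. unit_links_in H e)"

lemma unit_links_eq_UN_nodes:
  assumes "\<And>e. e \<in> H \<Longrightarrow> e \<subseteq> N"
  shows "unit_links H = (\<Union>i\<in>N. unit_links_at H i)"
  using assms unfolding unit_links_def unit_links_in_def unit_links_at_def links_at_def by blast

definition complete_links :: "'a set set \<Rightarrow> 'a unit_link set \<Rightarrow> 'a set set" where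
  "complete_links H S = {e \<in> H. unit_links_in H e \<subseteq> S}"

definition uniform_hyperlink_game ::
    "'a set \<Rightarrow> ('a set \<Rightarrow> real) \<Rightarrow> 'a set set \<Rightarrow> 'a unit_link set \<Rightarrow> real" where
  "uniform_hyperlink_game N v H S = hyperlink_game N v (complete_links H S)"

end

(* The Shapley value is linear, and the unanimity game on T splits one unit equally among the
   members of T. Expand the hyperlink game in unanimity games on sets T of hyperlinks; the uniform
   hyperlink game then has the same coefficients, on the sets of all unit links of members of T.
   Each hyperlink owns exactly eta unit links, so each unit link of e receives 1/eta of the Shapley
   value of e; node i owns eta/|e| of the unit links of e. *)

theory Submission
  imports Defs "HOL-Combinatorics.Transposition"
begin

section \<open>The Shapley value of unanimity games\<close>

definition unanimity_game :: "'a set \<Rightarrow> 'a set \<Rightarrow> real" where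
  "unanimity_game T S = of_bool (T \<subseteq> S)"

text \<open>Induction on \<open>N\<close>: adding a player \<open>x\<close> splits \<open>g\<close>
  into its values on coalitions without \<open>x\<close> and the marginal contribution of
  \<open>x\<close>, and both parts have expansions over \<open>N\<close>. The empty set is among the
  indices; its unanimity game is constantly 1 and carries the value \<open>g {}\<close>.\<close>

lemma unanimity_expansion:
  assumes "finite N"
  shows "\<exists>c. \<forall>S\<subseteq>N. g S = (\<Sum>T\<in>Pow N. c T * unanimity_game T S)"
  using assms
proof (induction N arbitrary: g rule: finite_induct)
  case empty
  show ?case
    by (intro exI[of _ g]) (simp add: unanimity_game_def)
next
  case (insert x N)
  obtain c where c: "\<And>S. S \<subseteq> N \<Longrightarrow> g S = (\<Sum>T\<in>Pow N. c T * unanimity_game T S)"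
    using insert.IH[of g] by blast
  obtain d where d: "\<And>S. S \<subseteq> N \<Longrightarrow>
      g (insert x S) - g S = (\<Sum>T\<in>Pow N. d T * unanimity_game T S)"
    using insert.IH[of "\<lambda>S. g (insert x S) - g S"] by blast
  \<comment> \<open>Sets without \<open>x\<close> keep the coefficients of \<open>g\<close>; a set
    with \<open>x\<close> takes the coefficient that the marginal contribution of \<open>x\<close>
    has at the set stripped of \<open>x\<close>.\<close>
  define b where "b T = (if x \<in> T then d (T - {x}) else c T)" for T
  have "g S = (\<Sum>T\<in>Pow (insert x N). b T * unanimity_game T S)" if S: "S \<subseteq> insert x N" for S
  proof -
    let ?S = "S - {x}"
    have S': "?S \<subseteq> N"
      using S by blast
    have inj: "inj_on (insert x) (Pow N)"
      using insert.hyps by (auto simp: inj_on_def)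
    have "(\<Sum>T\<in>Pow (insert x N). b T * unanimity_game T S) =
        (\<Sum>T\<in>Pow N. b T * unanimity_game T S) +
        (\<Sum>T\<in>insert x ` Pow N. b T * unanimity_game T S)"
      unfolding Pow_insert using insert.hyps by (intro sum.union_disjoint) auto
    also have "(\<Sum>T\<in>insert x ` Pow N. b T * unanimity_game T S) =
        (\<Sum>T\<in>Pow N. b (insert x T) * unanimity_game (insert x T) S)"
      using inj by (simp add: sum.reindex)
    \<comment> \<open>Sets containing \<open>x\<close> count only for coalitions containing
      \<open>x\<close>, where they add exactly the marginal contribution of \<open>x\<close> to
      \<open>?S\<close>.\<close>
    also have "\<dots> = (\<Sum>T\<in>Pow N. of_bool (x \<in> S) * (d T * unanimity_game T ?S))"
    proof (rule sum.cong[OF refl])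
      fix T assume "T \<in> Pow N"
      then have "x \<notin> T" using insert.hyps by blast
      then show "b (insert x T) * unanimity_game (insert x T) S =
          of_bool (x \<in> S) * (d T * unanimity_game T ?S)"
        by (auto simp: b_def unanimity_game_def)
    qed
    also have "\<dots> = of_bool (x \<in> S) * (g (insert x ?S) - g ?S)"
      using d[OF S'] by (simp add: sum_distrib_left)
    also have "(\<Sum>T\<in>Pow N. b T * unanimity_game T S) = (\<Sum>T\<in>Pow N. c T * unanimity_game T ?S)"
    proof (rule sum.cong[OF refl])
      fix T assume "T \<in> Pow N"
      then have "x \<notin> T" using insert.hyps by blast
      then show "b T * unanimity_game T S = c T * unanimity_game T ?S"
        by (auto simp: b_def unanimity_game_def)
    qed
    also have "\<dots> = g ?S"
      using c[OF S'] by simp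
    finally show ?thesis
      by (cases "x \<in> S") (simp_all add: insert_absorb)
  qed
  then show ?case by blast
qed

section \<open>Linearity of the Shapley value\<close>

text \<open>Expansions in unanimity games hold only on coalitions of players. This lets them be
  substituted, since every coalition that the Shapley value evaluates lies inside
  \<open>N\<close>.\<close>

lemma shapley_value_cong:
  assumes "i \<in> N" and "\<And>S. S \<subseteq> N \<Longrightarrow> v S = w S"
  shows "shapley_value N v i = shapley_value N w i"
proof -
  have "v (predecessors N \<sigma> i \<union> {i}) = w (predecessors N \<sigma> i \<union> {i})"
    "v (predecessors N \<sigma> i) = w (predecessors N \<sigma> i)" for \<sigma>
    using assms by (auto simp: predecessors_def)
  then show ?thesis
    by (simp add: shapley_value_def)
qed

lemma shapley_value_linear:
  "shapley_value N (\<lambda>S. \<Sum>T\<in>A. c T * u T S) i = (\<Sum>T\<in>A. c T * shapley_value N (u T) i)"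
proof -
  have "(\<Sum>\<sigma>\<in>permutations_of N. (\<Sum>T\<in>A. c T * u T (predecessors N \<sigma> i \<union> {i})) -
        (\<Sum>T\<in>A. c T * u T (predecessors N \<sigma> i))) =
      (\<Sum>T\<in>A. c T * (\<Sum>\<sigma>\<in>permutations_of N.
        u T (predecessors N \<sigma> i \<union> {i}) - u T (predecessors N \<sigma> i)))"
    unfolding sum_subtractf[symmetric] sum_distrib_left
    by (subst sum.swap) (simp add: algebra_simps)
  then show ?thesis
    by (simp add: shapley_value_def sum_distrib_left mult_ac)
qed

section \<open>Orderings and the last member of a coalition\<close>

lemma finite_permutations_of: "finite N \<Longrightarrow> finite (permutations_of N)"
  unfolding permutations_of_def
  by (rule finite_subset[of _ "N \<rightarrow>\<^sub>E {1..card N}"]) (auto intro: finite_PiE)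

lemma restrict_permutations_of:
  assumes "bij_betw f N {1..card N}"
  shows "restrict f N \<in> permutations_of N"
proof -
  have "bij_betw (restrict f N) N {1..card N}"
    using assms by (rule iffD2[OF bij_betw_cong, rotated]) simp
  then show ?thesis
    using bij_betwE[OF assms] by (simp add: permutations_of_def restrict_PiE_iff)
qed

lemma permutations_of_nonempty:
  assumes "finite N"
  shows "permutations_of N \<noteq> {}"
proof -
  obtain f where f: "bij_betw f N {1..card N}"
    using finite_same_card_bij[OF assms, of "{1..card N}"] by auto
  then show ?thesis
    using restrict_permutations_of by blast
qed

text \<open>For \<open>i\<close> in \<open>T\<close>, the event that the arrival of \<open>i\<close>
  completes \<open>T\<close>, so that \<open>i\<close> is pivotal in the unanimity game on
  \<open>T\<close>.\<close>

definition last_in :: "'a set \<Rightarrow> ('a \<Rightarrow> nat) \<Rightarrow> 'a \<Rightarrow> bool" where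
  "last_in T \<sigma> i \<longleftrightarrow> (\<forall>j\<in>T. j \<noteq> i \<longrightarrow> \<sigma> j < \<sigma> i)"

lemma transpose_permutations_of:
  assumes "i \<in> N" "j \<in> N" "\<sigma> \<in> permutations_of N"
  shows "restrict (\<sigma> \<circ> transpose i j) N \<in> permutations_of N"
proof -
  have t: "bij_betw (transpose i j) N N"
    using assms by (intro bij_betw_transpose_iff) auto
  have "bij_betw (\<sigma> \<circ> transpose i j) N {1..card N}"
    using t assms(3) by (auto simp: permutations_of_def intro: bij_betw_trans)
  then show ?thesis
    by (rule restrict_permutations_of)
qed

text \<open>Exchanging the ranks of \<open>i\<close> and \<open>j\<close> is an involution on the
  permutations; it matches the orderings in which \<open>i\<close> is last in \<open>T\<close> with
  those in which \<open>j\<close> is.\<close>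

lemma sum_last_in_eq:
  assumes "T \<subseteq> N" "i \<in> T" "j \<in> T"
  shows "(\<Sum>\<sigma>\<in>permutations_of N. of_bool (last_in T \<sigma> i)) =
    (\<Sum>\<sigma>\<in>permutations_of N. of_bool (last_in T \<sigma> j) :: real)"
proof -
  let ?f = "\<lambda>\<sigma>. restrict (\<sigma> \<circ> transpose i j) N"
  have ij: "i \<in> N" "j \<in> N"
    using assms by auto
  have inv: "?f (?f \<sigma>) = \<sigma>" if "\<sigma> \<in> permutations_of N" for \<sigma>
  proof
    fix x show "?f (?f \<sigma>) x = \<sigma> x"
      \<comment> \<open>Outside \<open>N\<close> both sides are \<open>undefined\<close>, by
        extensionality of \<open>\<sigma>\<close>.\<close>
      using that ij by (cases "x \<in> N")
        (auto simp: permutations_of_def PiE_def extensional_def transpose_def)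
  qed
  \<comment> \<open>Both \<open>i\<close> and \<open>j\<close> lie in \<open>T\<close>, so the
    transposition maps \<open>T\<close> onto itself.\<close>
  have last: "last_in T (?f \<sigma>) j \<longleftrightarrow> last_in T \<sigma> i" for \<sigma>
    using assms ij unfolding last_in_def
    by (auto simp: transpose_def subset_iff split: if_splits)
  show ?thesis
    by (rule sum.reindex_bij_witness[of _ ?f ?f])
       (use inv last transpose_permutations_of[OF ij] in auto)
qed

text \<open>Ranks are distinct, so exactly one member of \<open>T\<close> attains the maximal
  rank.\<close>

lemma sum_last_in_eq_1:
  assumes "finite N" "T \<subseteq> N" "T \<noteq> {}" "\<sigma> \<in> permutations_of N"
  shows "(\<Sum>i\<in>T. of_bool (last_in T \<sigma> i)) = (1 :: real)"
proof -
  have T: "finite T"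
    using assms finite_subset by blast
  have inj: "inj_on \<sigma> T"
    using assms by (auto simp: permutations_of_def bij_betw_def intro: inj_on_subset)
  have "Max (\<sigma> ` T) \<in> \<sigma> ` T"
    using T assms(3) by simp
  then obtain m where m: "m \<in> T" "\<sigma> m = Max (\<sigma> ` T)"
    by force
  have le: "\<sigma> j \<le> \<sigma> m" if "j \<in> T" for j
    using that T m by simp
  have "last_in T \<sigma> i \<longleftrightarrow> i = m" if "i \<in> T" for i
    using that le m inj unfolding last_in_def inj_on_def
    by (metis leD le_neq_implies_less)
  then have "(\<Sum>i\<in>T. of_bool (last_in T \<sigma> i)) = (\<Sum>i\<in>T. if i = m then 1 else (0 :: real))"
    by (intro sum.cong) auto
  then show ?thesis
    using T m by simp
qed

text \<open>A player outside \<open>T\<close> has only zero marginal contributions. A player in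
  \<open>T\<close> contributes 1 exactly when last in \<open>T\<close>; by symmetry all members are
  last equally often, and each ordering has one last member.\<close>

lemma shapley_value_unanimity_game:
  assumes "finite N" "T \<subseteq> N"
  shows "shapley_value N (unanimity_game T) i = (if i \<in> T then 1 / card T else 0)"
proof (cases "i \<in> T")
  case False
  then have "unanimity_game T (predecessors N \<sigma> i \<union> {i}) =
      unanimity_game T (predecessors N \<sigma> i)" for \<sigma>
    by (auto simp: unanimity_game_def)
  then show ?thesis
    using False by (simp add: shapley_value_def)
next
  case True
  define s where "s j = (\<Sum>\<sigma>\<in>permutations_of N. of_bool (last_in T \<sigma> j) :: real)" for j
  have "unanimity_game T (predecessors N \<sigma> i \<union> {i}) - unanimity_game T (predecessors N \<sigma> i) =
      of_bool (last_in T \<sigma> i)" for \<sigma>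
    using True assms(2)
    by (auto simp: unanimity_game_def predecessors_def last_in_def of_bool_def)
  then have sh: "shapley_value N (unanimity_game T) i = s i / card (permutations_of N)"
    by (simp add: shapley_value_def s_def)
  \<comment> \<open>Double counting of the pairs of an ordering and its last member of
    \<open>T\<close>.\<close>
  have "card T * s i = (\<Sum>j\<in>T. s j)"
    using sum_last_in_eq[OF assms(2) _ True] by (simp add: s_def)
  also have "\<dots> = (\<Sum>\<sigma>\<in>permutations_of N. \<Sum>j\<in>T. of_bool (last_in T \<sigma> j))"
    unfolding s_def by (rule sum.swap)
  also have "\<dots> = card (permutations_of N)"
    using sum_last_in_eq_1[OF assms] True by (subst sum.cong[OF refl, where h = "\<lambda>_. 1"]) auto
  finally have total: "card (permutations_of N) = card T * s i" ..
  have "card (permutations_of N) \<noteq> 0" "card T \<noteq> 0"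
    using assms True finite_permutations_of permutations_of_nonempty finite_subset
    by (auto simp: card_eq_0_iff)
  then show ?thesis
    using sh True total by auto
qed

section \<open>Unit links\<close>

lemma card_unit_links_at_in: "card (unit_links_at_in H i e) = eta H div card e"
proof -
  have "unit_links_at_in H i e = (\<lambda>k. (i, e, k)) ` {1..eta H div card e}"
    by (auto simp: unit_links_at_in_def)
  then show ?thesis
    by (simp add: card_image inj_on_def)
qed

lemma finite_unit_links_at_in: "finite (unit_links_at_in H i e)"
  by (simp add: unit_links_at_in_def)

lemma finite_unit_links_in: "finite e \<Longrightarrow> finite (unit_links_in H e)"
  by (simp add: unit_links_in_def finite_unit_links_at_in)

text \<open>A unit link records its hyperlink, so distinct hyperlinks own disjoint sets of unit
  links.\<close>

lemma unit_links_in_memD: "l \<in> unit_links_in H e \<Longrightarrow> fst (snd l) = e"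
  by (auto simp: unit_links_in_def unit_links_at_in_def)

lemma card_unit_links_in:
  assumes "e \<in> H" "finite e"
  shows "card (unit_links_in H e) = eta H"
proof -
  have "card (unit_links_in H e) = (\<Sum>i\<in>e. card (unit_links_at_in H i e))"
    unfolding unit_links_in_def using assms
    by (intro card_UN_disjoint) (auto simp: finite_unit_links_at_in unit_links_at_in_def)
  also have "\<dots> = card e * (eta H div card e)"
    by (simp add: card_unit_links_at_in)
  \<comment> \<open>The division is exact because \<open>card e\<close> divides the least common
    multiple.\<close>
  also have "\<dots> = eta H"
    using assms by (simp add: eta_def)
  finally show ?thesis .
qed

text \<open>Both games have the same coefficients over sets \<open>T\<close> of hyperlinks. Passing
  from \<open>T\<close> to its unit links multiplies the size by \<open>eta H\<close>, hence divides
  each share by \<open>eta H\<close>.\<close>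

lemma shapley_value_uniform_hyperlink_game:
  assumes H: "finite H" and fin: "\<And>e. e \<in> H \<Longrightarrow> finite e"
    and e: "e \<in> H" and l: "l \<in> unit_links_in H e"
  shows "shapley_value (unit_links H) (uniform_hyperlink_game N v H) l =
    shapley_value H (hyperlink_game N v) e / eta H"
proof -
  define U where "U T = (\<Union>f\<in>T. unit_links_in H f)" for T
  have U_H: "unit_links H = U H"
    by (simp add: U_def unit_links_def)
  have U_mono: "U T \<subseteq> U H" if "T \<subseteq> H" for T
    using that by (auto simp: U_def)
  have fin_U: "finite (U H)"
    using H fin by (auto simp: U_def finite_unit_links_in)
  have card_U: "card (U T) = card T * eta H" if "T \<subseteq> H" for T
  proof -
    have "card (U T) = (\<Sum>f\<in>T. card (unit_links_in H f))"
      unfolding U_def using that H fin finite_subset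
      by (intro card_UN_disjoint) (auto simp: finite_unit_links_in dest!: unit_links_in_memD)
    also have "\<dots> = (\<Sum>f\<in>T. eta H)"
      using that fin by (intro sum.cong) (auto simp: card_unit_links_in)
    finally show ?thesis by simp
  qed
  have l_U: "l \<in> U T \<longleftrightarrow> e \<in> T" for T
    using l by (auto simp: U_def dest: unit_links_in_memD)
  obtain c where c: "\<And>S. S \<subseteq> H \<Longrightarrow>
      hyperlink_game N v S = (\<Sum>T\<in>Pow H. c T * unanimity_game T S)"
    using unanimity_expansion[OF H] by blast
  \<comment> \<open>All members of \<open>T\<close> are complete in \<open>S\<close> exactly when
    \<open>S\<close> contains every unit link of \<open>T\<close>; this transfers the
    coefficients.\<close>
  have complete: "unanimity_game T (complete_links H S) = unanimity_game (U T) S"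
    if "T \<subseteq> H" for T S
    using that by (auto simp: unanimity_game_def complete_links_def U_def of_bool_def)
  have w: "uniform_hyperlink_game N v H S = (\<Sum>T\<in>Pow H. c T * unanimity_game (U T) S)" for S
  proof -
    have "complete_links H S \<subseteq> H"
      by (auto simp: complete_links_def)
    then show ?thesis
      by (simp add: uniform_hyperlink_game_def c complete)
  qed
  have "shapley_value (unit_links H) (uniform_hyperlink_game N v H) l =
      (\<Sum>T\<in>Pow H. c T * shapley_value (U H) (unanimity_game (U T)) l)"
    unfolding w U_H by (rule shapley_value_linear)
  \<comment> \<open>By \<open>l_U\<close> the same sets \<open>T\<close> contribute on both sides,
    with share \<open>1 / (card T * eta H)\<close> on the left.\<close>
  also have "\<dots> = (\<Sum>T\<in>Pow H. c T * shapley_value H (unanimity_game T) e / eta H)"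
    using U_mono
    by (intro sum.cong)
       (auto simp: shapley_value_unanimity_game[OF fin_U] shapley_value_unanimity_game[OF H]
          l_U card_U)
  also have "\<dots> = shapley_value H (\<lambda>S. \<Sum>T\<in>Pow H. c T * unanimity_game T S) e / eta H"
    by (simp add: shapley_value_linear sum_divide_distrib)
  also have "shapley_value H (\<lambda>S. \<Sum>T\<in>Pow H. c T * unanimity_game T S) e =
      shapley_value H (hyperlink_game N v) e"
    using e c by (intro shapley_value_cong) auto
  finally show ?thesis .
qed

theorem theorem3p1:
  fixes n :: nat and v :: "nat set \<Rightarrow> real" and H :: "nat set set" and i :: nat
  assumes "hypergraph_communication_situation n v H"
    and "i \<in> {1..n}"
  shows "position_value {1..n} v H i =
    (\<Sum>l\<in>unit_links_at H i. shapley_value (unit_links H) (uniform_hyperlink_game {1..n} v H) l)"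
proof -
  let ?N = "{1..n}"
  have sub: "H \<subseteq> {e. e \<subseteq> ?N \<and> card e > 1}"
    using assms(1) by (simp add: hypergraph_communication_situation_def)
  have H: "finite H"
    by (rule finite_subset[of _ "Pow ?N"]) (use sub in auto)
  have fin: "finite e" "card e > 0" if "e \<in> H" for e
    using that sub finite_subset[of e ?N] by auto
  \<comment> \<open>A zero cardinality would make the \<open>Lcm\<close> zero; positivity of
    \<open>eta H\<close> is what permits its cancellation at the end.\<close>
  have "0 \<notin> card ` H"
    using fin(2) by fastforce
  then have eta: "eta H > 0"
    using H by (simp add: eta_def Lcm_0_iff Nat.neq0_conv[symmetric])
  have "(\<Sum>l\<in>unit_links_at H i. shapley_value (unit_links H) (uniform_hyperlink_game ?N v H) l) =
      (\<Sum>e\<in>links_at H i. \<Sum>l\<in>unit_links_at_in H i e.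
        shapley_value (unit_links H) (uniform_hyperlink_game ?N v H) l)"
    \<comment> \<open>The hyperlink stored in each unit link makes the union over the hyperlinks at
      \<open>i\<close> disjoint.\<close>
    unfolding unit_links_at_def using H
    by (intro sum.UNION_disjoint)
       (auto simp: links_at_def finite_unit_links_at_in unit_links_at_in_def)
  also have "\<dots> = (\<Sum>e\<in>links_at H i. 1 / card e * shapley_value H (hyperlink_game ?N v) e)"
  proof (rule sum.cong[OF refl])
    fix e assume "e \<in> links_at H i"
    then have e: "e \<in> H" "i \<in> e"
      by (auto simp: links_at_def)
    have "(\<Sum>l\<in>unit_links_at_in H i e.
          shapley_value (unit_links H) (uniform_hyperlink_game ?N v H) l) =
        (\<Sum>l\<in>unit_links_at_in H i e. shapley_value H (hyperlink_game ?N v) e / eta H)"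
      using e by (intro sum.cong refl shapley_value_uniform_hyperlink_game[OF H fin(1)])
        (auto simp: unit_links_in_def)
    also have "\<dots> = real (eta H div card e) * (shapley_value H (hyperlink_game ?N v) e / eta H)"
      by (simp add: card_unit_links_at_in)
    \<comment> \<open>Exact division again: the natural quotient equals the real one.\<close>
    also have "real (eta H div card e) = real (eta H) / real (card e)"
      using e by (intro real_of_nat_div) (simp add: eta_def)
    finally show "(\<Sum>l\<in>unit_links_at_in H i e.
          shapley_value (unit_links H) (uniform_hyperlink_game ?N v H) l) =
        1 / card e * shapley_value H (hyperlink_game ?N v) e"
      using eta by simp
  qed
  finally show ?thesis
    by (simp add: position_value_def)
qed

end
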